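(* Let $g_N^{\pi(R)}$ be the gain (long-run average cost) associated with the random policy $\pi(R)$ in the naive $N$-reel system, and let $(g_1,h_1)$ be any solution of the single-reel Bellman equation $$h_1(w)=-g_1+\sum_{x'}p(x')\big(c(w,x')+h_1(e(w,x'))\big)\quad\text{for all }w\in\mathbf W.$$ Then the function defined for every state $(w_1,\dots,w_N)\in\mathbf W^N$ by $$h_N^{\pi(R)}(w_1,\dots,w_N)=\sum_{n=1}^N h_1(w_n)$$ is a solution to the Bellman equation of the naive $N$-reel system under $\pi(R)$, namely $$h_N^{\pi(R)}(w_1,\dots,w_N)=-g_N^{\pi(R)}+\frac1N\sum_{n=1}^N\sum_{x'}p(x')\Big[c(w_n,x')+h_N^{\pi(R)}(w_1,\dots,e(w_n,x'),\dots,w_N)\Big].$$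
   Context: Let $B$ and $N$ be positive integers ($B$ is the weight of a new reel, $N$ the number of reels), $\mathbf W=\{0,1,\dots,B-1\}$ the set of reel weights and $\mathbf X=\{1,\dots,B\}$ the set of component weights. Component weights are i.i.d. with a probability mass function $p$ on $\mathbf X$. For $w\in\mathbf W$, $x\in\mathbf X$ put $e(w,x)=w-x$ if $w\ge x$ and $e(w,x)=B-x$ otherwise (reel weight after assigning a component of weight $x$); $c(w,x)=0$ if $w\ge x$ and $c(w,x)=w$ otherwise (discarded weight, the one-step cost). Naive $N$-reel system under the random policy $\pi(R)$: the state is $(w_1,\dots,w_N)\in\mathbf W^N$. In each period a reel $n\in\{1,\dots,N\}$ is chosen uniformly at random, independently of everything else, then a component weight $x'\sim p$ is drawn, cost $c(w_n,x')$ is incurred and $w_n$ is replaced by $e(w_n,x')$, the other reels being unchanged. Its gain is $g_N^{\pi(R)}=\lim_{T\to\infty}\frac1T\sum_{t=1}^T\mathbb E[\text{cost incurred in period }t]$. In $(w_1,\dots,e(w_n,x'),\dots,w_N)$ only the $n$-th entry is replaced. Sums over $x'$ run over $\mathbf X$. *)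

theory Defs
  imports "HOL-Probability.Probability"
begin

definition reel_weights :: "nat \<Rightarrow> nat set" where
  "reel_weights B = {0..<B}"

definition component_weights :: "nat \<Rightarrow> nat set" where
  "component_weights B = {1..B}"

text \<open>The subtractions do not truncate for \<open>x \<in> component_weights B\<close>.\<close>

definition next_weight :: "nat \<Rightarrow> nat \<Rightarrow> nat \<Rightarrow> nat" where
  "next_weight B w x = (if x \<le> w then w - x else B - x)"

definition cost :: "nat \<Rightarrow> nat \<Rightarrow> nat" where
  "cost w x = (if x \<le> w then 0 else w)"

text \<open>A state of the \<open>N\<close>-reel system is a function on the reel indices \<open>{1..N}\<close>,
  extensional outside of them.\<close>

definition states :: "nat \<Rightarrow> nat \<Rightarrow> (nat \<Rightarrow> nat) set" where
  "states B N = {1..N} \<rightarrow>\<^sub>E reel_weights B"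

text \<open>Joint law of the cost incurred in one period and the state after that period, for the
  naive system under the random policy and starting the period in state \<open>w\<close>.\<close>

definition random_period ::
  "nat \<Rightarrow> nat \<Rightarrow> nat pmf \<Rightarrow> (nat \<Rightarrow> nat) \<Rightarrow> (nat \<times> (nat \<Rightarrow> nat)) pmf" where
  "random_period B N p w =
     bind_pmf (pmf_of_set {1..N}) (\<lambda>n.
       map_pmf (\<lambda>x. (cost (w n) x, w(n := next_weight B (w n) x))) p)"

text \<open>Law of the state after \<open>t\<close> periods, from the initial state \<open>w0\<close>.\<close>

primrec state_law ::
  "nat \<Rightarrow> nat \<Rightarrow> nat pmf \<Rightarrow> (nat \<Rightarrow> nat) \<Rightarrow> nat \<Rightarrow> (nat \<Rightarrow> nat) pmf" where
  "state_law B N p w0 0 = return_pmf w0"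
| "state_law B N p w0 (Suc t) =
     bind_pmf (state_law B N p w0 t) (\<lambda>w. map_pmf snd (random_period B N p w))"

text \<open>Periods are numbered from 1, so period \<open>t\<close> starts after \<open>t - 1\<close> periods.\<close>

definition expected_cost ::
  "nat \<Rightarrow> nat \<Rightarrow> nat pmf \<Rightarrow> (nat \<Rightarrow> nat) \<Rightarrow> nat \<Rightarrow> real" where
  "expected_cost B N p w0 t =
     measure_pmf.expectation
       (bind_pmf (state_law B N p w0 (t - 1)) (\<lambda>w. map_pmf fst (random_period B N p w))) real"

definition average_cost ::
  "nat \<Rightarrow> nat \<Rightarrow> nat pmf \<Rightarrow> (nat \<Rightarrow> nat) \<Rightarrow> nat \<Rightarrow> real" where
  "average_cost B N p w0 T = 1 / real T * (\<Sum>t = 1..T. expected_cost B N p w0 t)"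

definition gain :: "nat \<Rightarrow> nat \<Rightarrow> nat pmf \<Rightarrow> (nat \<Rightarrow> nat) \<Rightarrow> real" where
  "gain B N p w0 = lim (average_cost B N p w0)"

definition single_reel_bellman :: "nat \<Rightarrow> nat pmf \<Rightarrow> real \<Rightarrow> (nat \<Rightarrow> real) \<Rightarrow> bool" where
  "single_reel_bellman B p g h \<longleftrightarrow>
     (\<forall>w \<in> reel_weights B.
        h w = - g + (\<Sum>x \<in> component_weights B.
                       pmf p x * (real (cost w x) + h (next_weight B w x))))"

definition random_policy_bellman ::
  "nat \<Rightarrow> nat \<Rightarrow> nat pmf \<Rightarrow> real \<Rightarrow> ((nat \<Rightarrow> nat) \<Rightarrow> real) \<Rightarrow> bool" where
  "random_policy_bellman B N p g h \<longleftrightarrow>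
     (\<forall>w \<in> states B N.
        h w = - g + 1 / real N * (\<Sum>n = 1..N. \<Sum>x \<in> component_weights B.
                       pmf p x * (real (cost (w n) x) + h (w(n := next_weight B (w n) x)))))"

end

theory Submission
  imports Defs
begin

text \<open>
  Write \<open>H w = (\<Sum>n = 1..N. h1 (w n))\<close>. Replacing the weight of one reel \<open>n\<close> changes only the
  \<open>n\<close>-th summand of \<open>H\<close>, so by the single-reel equation an update of reel \<open>n\<close> incurs an expected
  cost plus an expected change of \<open>H\<close> of exactly \<open>g1\<close>, whichever \<open>n\<close> is chosen. Averaging over \<open>n\<close>
  shows that \<open>H\<close> solves the \<open>N\<close>-reel equation with the constant \<open>g1\<close>
  (\<open>random_policy_bellman_sum\<close>). No factor \<open>N\<close> appears: only one reel moves per period.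

  It remains to identify \<open>g1\<close> as the gain, which is the usual verification argument for Bellman
  equations (\<open>average_cost_tendsto\<close>). With \<open>W\<^sub>t\<close> the random state after \<open>t\<close> periods, the cost of period
  \<open>t + 1\<close> has mean \<open>g1 + E H(W\<^sub>t) - E H(W\<^sub>t\<^sub>+\<^sub>1)\<close>. These means telescope, and since the state
  space is finite the boundary terms stay bounded and vanish after division by the horizon.
  This gives both the existence of the limit and its value, from any initial state.
\<close>

section \<open>The state space is finite and closed under the dynamics\<close>

lemma finite_states: "finite (states B N)"
  unfolding states_def reel_weights_def by (intro finite_PiE) auto

lemma next_weight_in_reel_weights:
  assumes "w \<in> reel_weights B" "x \<in> component_weights B"
  shows "next_weight B w x \<in> reel_weights B"
  using assms by (auto simp: reel_weights_def component_weights_def next_weight_def)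

lemma states_update:
  assumes "w \<in> states B N" "n \<in> {1..N}" "x \<in> component_weights B"
  shows "w(n := next_weight B (w n) x) \<in> states B N"
proof -
  have "w n \<in> reel_weights B"
    using assms by (auto simp: states_def)
  then show ?thesis
    using assms next_weight_in_reel_weights[of "w n" B x]
    by (auto simp: states_def PiE_iff extensional_def)
qed

lemma set_random_period:
  assumes "N > 0" "set_pmf p \<subseteq> component_weights B"
  shows "set_pmf (random_period B N p w)
    \<subseteq> (\<lambda>(n, x). (cost (w n) x, w(n := next_weight B (w n) x))) ` ({1..N} \<times> component_weights B)"
proof -
  have "set_pmf (pmf_of_set {1..N}) = {1..N}"
    using assms(1) by (intro set_pmf_of_set) auto
  then show ?thesis
    using assms(2) unfolding random_period_def by auto
qed

lemma finite_set_random_period: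
  assumes "N > 0" "set_pmf p \<subseteq> component_weights B"
  shows "finite (set_pmf (random_period B N p w))"
  by (rule finite_subset[OF set_random_period[OF assms]]) (simp add: component_weights_def)

lemma set_state_law:
  assumes "N > 0" "set_pmf p \<subseteq> component_weights B" "w0 \<in> states B N"
  shows "set_pmf (state_law B N p w0 t) \<subseteq> states B N"
proof (induction t)
  case 0
  then show ?case using assms by simp
next
  case (Suc t)
  have "snd z \<in> states B N" if "w \<in> states B N" "z \<in> set_pmf (random_period B N p w)" for w z
    using that set_random_period[OF assms(1,2), of w] states_update by fastforce
  then show ?case using Suc by auto
qed

section \<open>One period\<close>

lemma expectation_random_period:
  fixes f :: "nat \<times> (nat \<Rightarrow> nat) \<Rightarrow> real"
  assumes "N > 0" "set_pmf p \<subseteq> component_weights B"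
  shows "measure_pmf.expectation (random_period B N p w) f =
    1 / real N * (\<Sum>n = 1..N. \<Sum>x \<in> component_weights B.
      pmf p x * f (cost (w n) x, w(n := next_weight B (w n) x)))"
proof -
  have fin: "finite (component_weights B)"
    by (simp add: component_weights_def)
  have "measure_pmf.expectation (random_period B N p w) f =
    (\<Sum>n\<in>{1..N}. measure_pmf.expectation
       (map_pmf (\<lambda>x. (cost (w n) x, w(n := next_weight B (w n) x))) p) f /\<^sub>R real (card {1..N}))"
    unfolding random_period_def
    by (rule pmf_expectation_bind_pmf_of_set)
       (use assms finite_subset[OF assms(2) fin] in auto)
  also have "\<dots> = (\<Sum>n = 1..N. 1 / real N * (\<Sum>x \<in> component_weights B.
      pmf p x * f (cost (w n) x, w(n := next_weight B (w n) x))))"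
  proof (rule sum.cong[OF refl])
    fix n
    have "measure_pmf.expectation p (\<lambda>x. f (cost (w n) x, w(n := next_weight B (w n) x))) =
      (\<Sum>x \<in> component_weights B. f (cost (w n) x, w(n := next_weight B (w n) x)) * pmf p x)"
      by (rule integral_measure_pmf_real[OF fin]) (use assms(2) in auto)
    then show "measure_pmf.expectation
        (map_pmf (\<lambda>x. (cost (w n) x, w(n := next_weight B (w n) x))) p) f /\<^sub>R real (card {1..N}) =
      1 / real N * (\<Sum>x \<in> component_weights B.
        pmf p x * f (cost (w n) x, w(n := next_weight B (w n) x)))"
      by (simp add: mult.commute divide_inverse)
  qed
  finally show ?thesis by (simp add: sum_distrib_left)
qed

text \<open>Since \<open>p\<close> has total mass 1 on the component weights, the summands of the other reels pass
  through the average over \<open>x\<close> unchanged, and the single-reel equation at \<open>w n\<close> accounts for the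
  remaining one. The constant \<open>g1\<close> is thus contributed once by each of the \<open>N\<close> choices of \<open>n\<close>,
  each of which has probability \<open>1 / N\<close>.\<close>

lemma random_policy_bellman_sum:
  assumes "N > 0" "set_pmf p \<subseteq> component_weights B" "single_reel_bellman B p g1 h1"
  shows "random_policy_bellman B N p g1 (\<lambda>w. \<Sum>n = 1..N. h1 (w n))"
  unfolding random_policy_bellman_def
proof (rule ballI)
  fix w assume w: "w \<in> states B N"
  let ?H = "\<lambda>w. \<Sum>n = 1..N. h1 (w n)"
  have mass: "(\<Sum>x \<in> component_weights B. pmf p x) = 1"
    by (rule sum_pmf_eq_1) (use assms(2) in \<open>auto simp: component_weights_def\<close>)
  have reel: "(\<Sum>x \<in> component_weights B.
      pmf p x * (real (cost (w n) x) + ?H (w(n := next_weight B (w n) x)))) = g1 + ?H w"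
    if n: "n \<in> {1..N}" for n
  proof -
    have wn: "w n \<in> reel_weights B"
      using w n by (auto simp: states_def)
    have upd: "?H (w(n := y)) = ?H w - h1 (w n) + h1 y" for y
      using n by (simp add: sum.remove[of _ n])
    have "(\<Sum>x \<in> component_weights B.
        pmf p x * (real (cost (w n) x) + ?H (w(n := next_weight B (w n) x)))) =
      (\<Sum>x \<in> component_weights B. pmf p x * (real (cost (w n) x) + h1 (next_weight B (w n) x))
        + pmf p x * (?H w - h1 (w n)))"
      unfolding upd by (intro sum.cong) (auto simp: algebra_simps)
    also have "\<dots> = (\<Sum>x \<in> component_weights B.
        pmf p x * (real (cost (w n) x) + h1 (next_weight B (w n) x))) + (?H w - h1 (w n))"
      by (simp only: sum.distrib sum_distrib_right[symmetric] mass mult_1)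
    also have "\<dots> = g1 + ?H w"
      using assms(3) wn unfolding single_reel_bellman_def by fastforce
    finally show ?thesis .
  qed
  have "(\<Sum>n = 1..N. \<Sum>x \<in> component_weights B.
      pmf p x * (real (cost (w n) x) + ?H (w(n := next_weight B (w n) x)))) =
    (\<Sum>n = 1..N. g1 + ?H w)"
    by (rule sum.cong[OF refl reel])
  also have "\<dots> = real N * (g1 + ?H w)"
    by simp
  finally show "?H w = - g1 + 1 / real N * (\<Sum>n = 1..N. \<Sum>x \<in> component_weights B.
      pmf p x * (real (cost (w n) x) + ?H (w(n := next_weight B (w n) x))))"
    using assms(1) by simp
qed

section \<open>The constant in the Bellman equation is the gain\<close>

text \<open>The Bellman equation at the random state reached after \<open>t\<close> periods, averaged over the law of
  that state.\<close>

lemma expected_cost_Suc: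
  assumes "N > 0" "set_pmf p \<subseteq> component_weights B" "w0 \<in> states B N"
    and bellman: "random_policy_bellman B N p g h"
  shows "expected_cost B N p w0 (Suc t) =
    g + measure_pmf.expectation (state_law B N p w0 t) h
      - measure_pmf.expectation (state_law B N p w0 (Suc t)) h"
proof -
  let ?Q = "state_law B N p w0 t" and ?R = "random_period B N p" and ?S = "states B N"
  note supp = set_state_law[OF assms(1-3), of t]
  note finR = finite_set_random_period[OF assms(1,2)]
  have period: "measure_pmf.expectation (?R w) (\<lambda>z. real (fst z)) +
      measure_pmf.expectation (?R w) (\<lambda>z. h (snd z)) = g + h w" if "w \<in> ?S" for w
  proof -
    have "measure_pmf.expectation (?R w) (\<lambda>z. real (fst z)) +
        measure_pmf.expectation (?R w) (\<lambda>z. h (snd z)) =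
      measure_pmf.expectation (?R w) (\<lambda>z. real (fst z) + h (snd z))"
      by (intro Bochner_Integration.integral_add[symmetric] integrable_measure_pmf_finite finR)
    also have "\<dots> = g + h w"
      using bellman that
      unfolding expectation_random_period[OF assms(1,2)] random_policy_bellman_def by fastforce
    finally show ?thesis .
  qed
  have mass: "(\<Sum>w\<in>?S. pmf ?Q w) = 1"
    by (rule sum_pmf_eq_1[OF finite_states supp])
  have cost: "expected_cost B N p w0 (Suc t) =
      (\<Sum>w\<in>?S. pmf ?Q w * measure_pmf.expectation (?R w) (\<lambda>z. real (fst z)))"
    unfolding expected_cost_def diff_Suc_1 using finR
    by (subst pmf_expectation_bind[OF finite_states _ supp]) auto
  have after: "measure_pmf.expectation (state_law B N p w0 (Suc t)) h =
      (\<Sum>w\<in>?S. pmf ?Q w * measure_pmf.expectation (?R w) (\<lambda>z. h (snd z)))"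
    unfolding state_law.simps using finR
    by (subst pmf_expectation_bind[OF finite_states _ supp]) auto
  have before: "measure_pmf.expectation ?Q h = (\<Sum>w\<in>?S. h w * pmf ?Q w)"
    by (rule integral_measure_pmf_real[OF finite_states]) (use supp in auto)
  have "expected_cost B N p w0 (Suc t) + measure_pmf.expectation (state_law B N p w0 (Suc t)) h =
      (\<Sum>w\<in>?S. pmf ?Q w * (g + h w))"
    unfolding cost after sum.distrib[symmetric] distrib_left[symmetric]
    by (intro sum.cong refl) (simp add: period)
  also have "\<dots> = g + measure_pmf.expectation ?Q h"
    unfolding before
    by (simp add: distrib_left sum.distrib mult.commute[of _ "h _"] sum_distrib_right[symmetric] mass)
  finally show ?thesis by simp
qed

lemma average_cost_tendsto:
  assumes "N > 0" "set_pmf p \<subseteq> component_weights B" "w0 \<in> states B N"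
    and "random_policy_bellman B N p g h"
  shows "average_cost B N p w0 \<longlonglongrightarrow> g"
proof -
  define E where "E t = measure_pmf.expectation (state_law B N p w0 t) h" for t
  define M where "M = (\<Sum>w\<in>states B N. \<bar>h w\<bar>)"
  have bound: "\<bar>E t\<bar> \<le> M" for t
  proof -
    have "E t = (\<Sum>w\<in>states B N. h w * pmf (state_law B N p w0 t) w)"
      unfolding E_def
      by (rule integral_measure_pmf_real[OF finite_states])
         (use set_state_law[OF assms(1-3)] in auto)
    also have "\<bar>\<dots>\<bar> \<le> (\<Sum>w\<in>states B N. \<bar>h w * pmf (state_law B N p w0 t) w\<bar>)"
      by (rule sum_abs)
    also have "\<dots> \<le> M"
      unfolding M_def by (intro sum_mono) (simp add: abs_mult mult_left_le pmf_le_1)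
    finally show ?thesis .
  qed
  have telescope: "(\<Sum>t = 1..T. expected_cost B N p w0 t) = real T * g + E 0 - E T" for T
  proof (induction T)
    case (Suc T)
    have "expected_cost B N p w0 (Suc T) = g + E T - E (Suc T)"
      unfolding E_def by (rule expected_cost_Suc[OF assms])
    then show ?case using Suc by (simp add: algebra_simps)
  qed simp
  have vanish: "(\<lambda>T. (E 0 - E T) / real T) \<longlonglongrightarrow> 0"
  proof (rule Lim_null_comparison)
    have "norm ((E 0 - E T) / real T) \<le> 2 * M / real T" for T
      using bound[of 0] bound[of T] by (auto intro!: divide_right_mono)
    then show "\<forall>\<^sub>F T in sequentially. norm ((E 0 - E T) / real T) \<le> 2 * M / real T"
      by simp
    show "(\<lambda>T. 2 * M / real T) \<longlonglongrightarrow> 0"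
      by (rule lim_const_over_n)
  qed
  have "(\<lambda>T. g + (E 0 - E T) / real T) \<longlonglongrightarrow> g"
    using tendsto_add[OF tendsto_const[of g] vanish] by simp
  moreover have "\<forall>\<^sub>F T in sequentially. average_cost B N p w0 T = g + (E 0 - E T) / real T"
    using eventually_gt_at_top[of 0]
    by eventually_elim (simp only: average_cost_def telescope, simp add: field_simps)
  ultimately show ?thesis
    by (simp add: tendsto_cong)
qed

theorem theorem4p3:
  fixes B N :: nat and p :: "nat pmf" and g1 :: real and h1 :: "nat \<Rightarrow> real"
    and w0 :: "nat \<Rightarrow> nat"
  assumes "B > 0" and "N > 0"
    and "set_pmf p \<subseteq> component_weights B"
    and "w0 \<in> states B N"
    and "single_reel_bellman B p g1 h1"
  shows "convergent (average_cost B N p w0) \<and>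
    random_policy_bellman B N p (gain B N p w0) (\<lambda>w. \<Sum>n = 1..N. h1 (w n))"
proof -
  have bellman: "random_policy_bellman B N p g1 (\<lambda>w. \<Sum>n = 1..N. h1 (w n))"
    by (rule random_policy_bellman_sum[OF assms(2,3,5)])
  have lim: "average_cost B N p w0 \<longlonglongrightarrow> g1"
    by (rule average_cost_tendsto[OF assms(2,3,4) bellman])
  then have "gain B N p w0 = g1"
    unfolding gain_def by (rule limI)
  with lim bellman show ?thesis
    by (auto simp: convergent_def)
qed

end
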